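(* Let $\mathfrak{X}$ be a decoration set. The product $\cdot$ and the coproduct $\triangle$ endow the graded vector space $\mathbf{k}\mathfrak{P}$ of $\mathfrak{X}$-decorated permutations with a graded Hopf algebra structure.
   Context: Notation. $\mathbb{N}=\{0,1,2,\dots\}$, $[n]=\{1,\dots,n\}$, $\mathfrak{S}_n$ is the set of permutations of $[n]$ in one-line notation, $\mathbf{k}$ is a field. A decoration set is a graded set $\mathfrak{X}=\bigsqcup_{n\ge0}\mathfrak{X}_n$ with a concatenation $\mathsf{concat}:\mathfrak{X}_m\times\mathfrak{X}_n\to\mathfrak{X}_{m+n}$ for all $m,n\in\mathbb{N}$ and a selection $\mathsf{select}:\mathfrak{X}_m\times\binom{[m]}{k}\to\mathfrak{X}_k$ for all $m,k\in\mathbb{N}$ (where $\binom{[m]}{k}$ is the set of $k$-element subsets of $[m]$) such that (i) $\mathsf{concat}(\mathcal{X},\mathsf{concat}(\mathcal{Y},\mathcal{Z}))=\mathsf{concat}(\mathsf{concat}(\mathcal{X},\mathcal{Y}),\mathcal{Z})$ for all $\mathcal{X},\mathcal{Y},\mathcal{Z}\in\mathfrak{X}$; (ii) $\mathsf{select}(\mathsf{select}(\mathcal{X},R),S)=\mathsf{select}(\mathcal{X},\{r_s : s\in S\})$ for all $\mathcal{X}\in\mathfrak{X}_p$, $R=\{r_1<\dots<r_q\}\subseteq[p]$, $S\subseteq[q]$; (iii) $\mathsf{concat}(\mathsf{select}(\mathcal{X},R),\mathsf{select}(\mathcal{Y},S))=\mathsf{select}(\mathsf{concat}(\mathcal{X},\mathcal{Y}),R\cup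 S^{\rightarrow m})$ for all $\mathcal{X}\in\mathfrak{X}_m$, $\mathcal{Y}\in\mathfrak{X}_n$, $R\subseteq[m]$, $S\subseteq[n]$, where $S^{\rightarrow m}=\{s+m : s\in S\}$. An $\mathfrak{X}$-decorated permutation of size $n$ is a pair $(\sigma,\mathcal{X})\in\mathfrak{P}_n:=\mathfrak{S}_n\times\mathfrak{X}_n$; $\mathbf{k}\mathfrak{P}=\bigoplus_{n\ge0}\mathbf{k}\mathfrak{P}_n$, where $\mathbf{k}\mathfrak{P}_n$ has basis $(\mathbb{F}_{(\sigma,\mathcal{X})})_{(\sigma,\mathcal{X})\in\mathfrak{P}_n}$. For $\rho\in\mathfrak{S}_p$ and $R\subseteq[p]$, $\mathsf{stdp}(\rho,R)$ (resp. $\mathsf{stdv}(\rho,R)$) is the standardization (the permutation with the same relative order) of the word obtained from $\rho$ by deleting the entries whose positions (resp. values) are not in $R$. For $\sigma\in\mathfrak{S}_m$, $\tau\in\mathfrak{S}_n$, the shifted shuffle is $\sigma\,\bar{\sqcup\!\sqcup}\,\tau=\{\rho\in\mathfrak{S}_{m+n} : \mathsf{stdv}(\rho,[m])=\sigma,\ \mathsf{stdv}(\rho,[m+n]\setminus[m])=\tau\}$. Product: $\mathbb{F}_{(\sigma,\mathcal{X})}\cdot\mathbb{F}_{(\tau,\mathcal{Y})}=\sum_{\rho\in\sigma\,\bar{\sqcup\!\sqcup}\,\tau}\mathbb{F}_{(\rho,\mathsf{concat}(\mathcal{X},\mathcal{Y}))}$. Coproduct: for $(\rho,\mathcal{Z})\in\mathfrak{P}_p$,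 $\triangle\mathbb{F}_{(\rho,\mathcal{Z})}=\sum_{k=0}^p\mathbb{F}_{\mathsf{std}((\rho,\mathcal{Z}),[k])}\otimes\mathbb{F}_{\mathsf{std}((\rho,\mathcal{Z}),[p]\setminus[k])}$, where $\mathsf{std}((\rho,\mathcal{Z}),R)=(\mathsf{stdp}(\rho,R),\mathsf{select}(\mathcal{Z},\rho(R)))$ and $\rho(R)=\{\rho_i : i\in R\}$. Here a (combinatorial) Hopf algebra is a vector space endowed with an associative product $\cdot$ and a coassociative coproduct $\triangle$ such that $\triangle(x\cdot y)=\triangle(x)\cdot\triangle(y)$, the product on the right being $(x_1\otimes x_2)\cdot(y_1\otimes y_2)=(x_1\cdot y_1)\otimes(x_2\cdot y_2)$; it is graded if product and coproduct respect the grading. *)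

theory Defs
  imports
    "HOL-Library.Poly_Mapping"
    "HOL-Library.Disjoint_Sets"
    "HOL-Combinatorics.Multiset_Permutations"
begin

section \<open>Free vector spaces and their tensor products\<close>

definition scale :: "'k::field \<Rightarrow> ('b \<Rightarrow>\<^sub>0 'k) \<Rightarrow> ('b \<Rightarrow>\<^sub>0 'k)" where
  "scale c x = Poly_Mapping.map ((*) c) x"

lemma lookup_scale [simp]:
  "Poly_Mapping.lookup (scale c x) b = c * Poly_Mapping.lookup x b"
  by (simp add: scale_def Poly_Mapping.map.rep_eq when_def)

global_interpretation free_vector_space: vector_space "scale :: 'k::field \<Rightarrow> ('b \<Rightarrow>\<^sub>0 'k) \<Rightarrow> _"
  by unfold_locales (auto intro!: poly_mapping_eqI simp: lookup_add algebra_simps)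

text \<open>The vector space with basis \<open>A\<close>, as a subspace of the vector space with basis the whole
  type.\<close>

definition free_on :: "'b set \<Rightarrow> ('b \<Rightarrow>\<^sub>0 'k::field) set" where
  "free_on A = {x. Poly_Mapping.keys x \<subseteq> A}"

abbreviation basis :: "'b \<Rightarrow> ('b \<Rightarrow>\<^sub>0 'k::field)" where
  "basis b \<equiv> Poly_Mapping.single b 1"

definition linear_on :: "('b \<Rightarrow>\<^sub>0 'k::field) set \<Rightarrow> (('b \<Rightarrow>\<^sub>0 'k) \<Rightarrow> ('c \<Rightarrow>\<^sub>0 'k)) \<Rightarrow> bool" where
  "linear_on V f \<longleftrightarrow>
     (\<forall>x\<in>V. \<forall>y\<in>V. f (x + y) = f x + f y) \<and> (\<forall>c. \<forall>x\<in>V. f (scale c x) = scale c (f x))"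

definition bilinear_on ::
  "('a \<Rightarrow>\<^sub>0 'k::field) set \<Rightarrow> ('b \<Rightarrow>\<^sub>0 'k) set \<Rightarrow>
   (('a \<Rightarrow>\<^sub>0 'k) \<Rightarrow> ('b \<Rightarrow>\<^sub>0 'k) \<Rightarrow> ('c \<Rightarrow>\<^sub>0 'k)) \<Rightarrow> bool" where
  "bilinear_on V W h \<longleftrightarrow> (\<forall>y\<in>W. linear_on V (\<lambda>x. h x y)) \<and> (\<forall>x\<in>V. linear_on W (h x))"

definition lin_ext :: "('b \<Rightarrow> ('c \<Rightarrow>\<^sub>0 'k::field)) \<Rightarrow> ('b \<Rightarrow>\<^sub>0 'k) \<Rightarrow> ('c \<Rightarrow>\<^sub>0 'k)" where
  "lin_ext f x = (\<Sum>b\<in>Poly_Mapping.keys x. scale (Poly_Mapping.lookup x b) (f b))"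

definition bilin_ext ::
  "('a \<Rightarrow> 'b \<Rightarrow> ('c \<Rightarrow>\<^sub>0 'k::field)) \<Rightarrow> ('a \<Rightarrow>\<^sub>0 'k) \<Rightarrow> ('b \<Rightarrow>\<^sub>0 'k) \<Rightarrow> ('c \<Rightarrow>\<^sub>0 'k)" where
  "bilin_ext h x y = lin_ext (\<lambda>a. lin_ext (h a) y) x"

text \<open>The tensor product of the spaces with bases \<open>A\<close> and \<open>B\<close> is \<open>free_on (A \<times> B)\<close>, with
  \<open>basis a \<otimes> basis b\<close> realised as \<open>basis (a, b)\<close>; see \<open>span_tensor\<close> and \<open>tensor_universal\<close>
  below.\<close>

definition tensor :: "('a \<Rightarrow>\<^sub>0 'k::field) \<Rightarrow> ('b \<Rightarrow>\<^sub>0 'k) \<Rightarrow> ('a \<times> 'b \<Rightarrow>\<^sub>0 'k)" where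
  "tensor = bilin_ext (\<lambda>a b. basis (a, b))"

definition tensor_map ::
  "(('a \<Rightarrow>\<^sub>0 'k::field) \<Rightarrow> ('c \<Rightarrow>\<^sub>0 'k)) \<Rightarrow> (('b \<Rightarrow>\<^sub>0 'k) \<Rightarrow> ('d \<Rightarrow>\<^sub>0 'k)) \<Rightarrow>
   ('a \<times> 'b \<Rightarrow>\<^sub>0 'k) \<Rightarrow> ('c \<times> 'd \<Rightarrow>\<^sub>0 'k)" where
  "tensor_map f g = lin_ext (\<lambda>(a, b). tensor (f (basis a)) (g (basis b)))"

definition tensor_mult ::
  "(('b \<Rightarrow>\<^sub>0 'k::field) \<Rightarrow> ('b \<Rightarrow>\<^sub>0 'k) \<Rightarrow> ('b \<Rightarrow>\<^sub>0 'k)) \<Rightarrow>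
   ('b \<times> 'b \<Rightarrow>\<^sub>0 'k) \<Rightarrow> ('b \<times> 'b \<Rightarrow>\<^sub>0 'k) \<Rightarrow> ('b \<times> 'b \<Rightarrow>\<^sub>0 'k)" where
  "tensor_mult m = bilin_ext (\<lambda>(a1, a2) (b1, b2).
     tensor (m (basis a1) (basis b1)) (m (basis a2) (basis b2)))"

definition tensor_assoc :: "(('a \<times> 'b) \<times> 'c \<Rightarrow>\<^sub>0 'k::field) \<Rightarrow> ('a \<times> 'b \<times> 'c \<Rightarrow>\<^sub>0 'k)" where
  "tensor_assoc = lin_ext (\<lambda>((a, b), c). basis (a, b, c))"

subsection \<open>Characteristic properties\<close>

lemma subspace_free_on: "free_vector_space.subspace (free_on A :: ('b \<Rightarrow>\<^sub>0 'k::field) set)"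
proof -
  have "x \<in> free_on A \<longleftrightarrow> (\<forall>b. b \<notin> A \<longrightarrow> Poly_Mapping.lookup x b = 0)" for x :: "'b \<Rightarrow>\<^sub>0 'k"
    by (auto simp: free_on_def in_keys_iff)
  then show ?thesis
    by (simp add: free_vector_space.subspace_def lookup_add)
qed

lemma free_on_add: "x \<in> free_on A \<Longrightarrow> y \<in> free_on A \<Longrightarrow> x + y \<in> free_on A"
  and free_on_scale: "x \<in> free_on A \<Longrightarrow> scale c x \<in> free_on A"
  and free_on_zero: "0 \<in> free_on A"
  using subspace_free_on[of A] by (auto simp: free_vector_space.subspace_def)

lemma free_on_sum: "(\<And>i. i \<in> I \<Longrightarrow> f i \<in> free_on A) \<Longrightarrow> sum f I \<in> free_on A"
  by (rule free_vector_space.subspace_sum[OF subspace_free_on])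

lemma basis_in_free_on [simp]: "basis a \<in> free_on A \<longleftrightarrow> a \<in> A"
  by (simp add: free_on_def)

lemma lin_ext_superset:
  assumes "finite A" "Poly_Mapping.keys x \<subseteq> A"
  shows "lin_ext f x = (\<Sum>b\<in>A. scale (Poly_Mapping.lookup x b) (f b))"
  unfolding lin_ext_def using assms
  by (intro sum.mono_neutral_left) (auto simp: in_keys_iff)

lemma lin_ext_basis [simp]: "lin_ext f (basis b) = f b"
  by (simp add: lin_ext_def)

lemma lin_ext_add: "lin_ext f (x + y) = lin_ext f x + lin_ext f y"
proof -
  let ?A = "Poly_Mapping.keys x \<union> Poly_Mapping.keys y"
  have "lin_ext f (x + y) = (\<Sum>b\<in>?A. scale (Poly_Mapping.lookup (x + y) b) (f b))"
    by (rule lin_ext_superset) (auto dest: subsetD[OF keys_add])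
  also have "\<dots> = (\<Sum>b\<in>?A. scale (Poly_Mapping.lookup x b) (f b)) +
                 (\<Sum>b\<in>?A. scale (Poly_Mapping.lookup y b) (f b))"
    by (simp add: lookup_add free_vector_space.scale_left_distrib sum.distrib)
  also have "\<dots> = lin_ext f x + lin_ext f y"
    by (simp add: lin_ext_superset[symmetric])
  finally show ?thesis .
qed

lemma lin_ext_scale: "lin_ext f (scale c x) = scale c (lin_ext f x)"
proof -
  have "lin_ext f (scale c x) =
        (\<Sum>b\<in>Poly_Mapping.keys x. scale (Poly_Mapping.lookup (scale c x) b) (f b))"
    by (rule lin_ext_superset) (auto simp: in_keys_iff)
  then show ?thesis
    by (simp add: lin_ext_def free_vector_space.scale_sum_right)
qed

lemma linear_on_lin_ext: "linear_on V (lin_ext f)"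
  by (simp add: linear_on_def lin_ext_add lin_ext_scale)

lemma lin_ext_fun_add: "lin_ext (\<lambda>a. f a + g a) x = lin_ext f x + lin_ext g x"
  by (simp add: lin_ext_def free_vector_space.scale_right_distrib sum.distrib)

lemma lin_ext_fun_scale: "lin_ext (\<lambda>a. scale c (f a)) x = scale c (lin_ext f x)"
  by (simp add: lin_ext_def free_vector_space.scale_sum_right mult.commute)

lemma linear_on_sum:
  assumes "linear_on (free_on A) f" "\<And>i. i \<in> I \<Longrightarrow> x i \<in> free_on A"
  shows "f (\<Sum>i\<in>I. x i) = (\<Sum>i\<in>I. f (x i))"
proof -
  have "f (scale 0 0) = scale 0 (f 0)"
    using assms(1) free_on_zero unfolding linear_on_def by blast
  then have "f 0 = 0" by simp
  then show ?thesis
    using assms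
    by (induction I rule: infinite_finite_induct) (auto simp: linear_on_def free_on_sum)
qed

lemma basis_expansion: "lin_ext basis x = x"
proof (rule poly_mapping_eqI)
  fix b
  show "Poly_Mapping.lookup (lin_ext basis x) b = Poly_Mapping.lookup x b"
    by (cases "b \<in> Poly_Mapping.keys x")
       (simp_all add: lin_ext_def lookup_sum lookup_single when_def if_distrib[of "(*) _"]
         in_keys_iff cong: if_cong)
qed

lemma linear_on_eq_lin_ext:
  assumes "linear_on (free_on A) f" "x \<in> free_on A"
  shows "f x = lin_ext (\<lambda>a. f (basis a)) x"
proof -
  have A: "a \<in> A" if "a \<in> Poly_Mapping.keys x" for a
    using assms(2) that by (auto simp: free_on_def)
  have "f x = f (\<Sum>a\<in>Poly_Mapping.keys x. scale (Poly_Mapping.lookup x a) (basis a))"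
    using basis_expansion[of x] by (simp add: lin_ext_def)
  also have "\<dots> = (\<Sum>a\<in>Poly_Mapping.keys x. f (scale (Poly_Mapping.lookup x a) (basis a)))"
    using assms(1) A by (intro linear_on_sum) (auto intro: free_on_scale)
  also have "\<dots> = lin_ext (\<lambda>a. f (basis a)) x"
    unfolding lin_ext_def using assms(1) A by (intro sum.cong) (auto simp: linear_on_def)
  finally show ?thesis .
qed

lemma bilin_ext_basis [simp]: "bilin_ext h (basis a) (basis b) = h a b"
  by (simp add: bilin_ext_def)

lemma bilinear_on_bilin_ext: "bilinear_on V W (bilin_ext h)"
  by (simp add: bilinear_on_def linear_on_def bilin_ext_def lin_ext_add lin_ext_scale
      lin_ext_fun_add lin_ext_fun_scale)

lemma bilinear_on_eq_bilin_ext: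
  assumes "bilinear_on (free_on A) (free_on B) h" "x \<in> free_on A" "y \<in> free_on B"
  shows "h x y = bilin_ext (\<lambda>a b. h (basis a) (basis b)) x y"
proof -
  have "h x y = lin_ext (\<lambda>a. h (basis a) y) x"
    using assms by (intro linear_on_eq_lin_ext[of A "\<lambda>x. h x y"]) (auto simp: bilinear_on_def)
  also have "\<dots> = lin_ext (\<lambda>a. lin_ext (\<lambda>b. h (basis a) (basis b)) y) x"
    unfolding lin_ext_def[of _ x]
  proof (rule sum.cong)
    fix a assume "a \<in> Poly_Mapping.keys x"
    then have "a \<in> A" using assms(2) by (auto simp: free_on_def)
    then have "h (basis a) y = lin_ext (\<lambda>b. h (basis a) (basis b)) y"
      using assms by (intro linear_on_eq_lin_ext[of B]) (auto simp: bilinear_on_def)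
    then show "scale (Poly_Mapping.lookup x a) (h (basis a) y) =
               scale (Poly_Mapping.lookup x a) (lin_ext (\<lambda>b. h (basis a) (basis b)) y)"
      by simp
  qed simp
  finally show ?thesis by (simp add: bilin_ext_def)
qed

lemma tensor_basis [simp]: "tensor (basis a) (basis b) = basis (a, b)"
  by (simp add: tensor_def)

lemma bilinear_on_tensor: "bilinear_on V W tensor"
  unfolding tensor_def by (rule bilinear_on_bilin_ext)

lemma tensor_add_left: "tensor (x + x') y = tensor x y + tensor x' y"
  and tensor_add_right: "tensor x (y + y') = tensor x y + tensor x y'"
  and tensor_scale_left: "tensor (scale c x) y = scale c (tensor x y)"
  and tensor_scale_right: "tensor x (scale c y) = scale c (tensor x y)"
  by (simp_all add: tensor_def bilin_ext_def lin_ext_add lin_ext_scale lin_ext_fun_add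
      lin_ext_fun_scale)

lemmas tensor_bilinear =
  tensor_add_left tensor_add_right tensor_scale_left tensor_scale_right

lemma lookup_tensor:
  "Poly_Mapping.lookup (tensor x y) (a, b) = Poly_Mapping.lookup x a * Poly_Mapping.lookup y b"
proof -
  have "Poly_Mapping.lookup (tensor x y) (a, b) =
    (\<Sum>a'\<in>Poly_Mapping.keys x. Poly_Mapping.lookup x a' *
      (\<Sum>b'\<in>Poly_Mapping.keys y. Poly_Mapping.lookup y b' * (if a' = a \<and> b' = b then 1 else 0)))"
    by (simp add: tensor_def bilin_ext_def lin_ext_def lookup_sum lookup_single when_def)
  also have "\<dots> = (\<Sum>a'\<in>Poly_Mapping.keys x. if a' = a
      then Poly_Mapping.lookup x a' * Poly_Mapping.lookup y b else 0)"
    by (intro sum.cong) (auto simp: if_distrib[of "(*) _"] in_keys_iff cong: if_cong)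
  also have "\<dots> = Poly_Mapping.lookup x a * Poly_Mapping.lookup y b"
    by (auto simp: in_keys_iff)
  finally show ?thesis .
qed

lemma tensor_in_free_on:
  assumes "x \<in> free_on A" "y \<in> free_on B"
  shows "tensor x y \<in> free_on (A \<times> B)"
proof -
  have "a \<in> A \<and> b \<in> B" if "(a, b) \<in> Poly_Mapping.keys (tensor x y)" for a b
    using that assms by (auto simp: free_on_def in_keys_iff lookup_tensor)
  then show ?thesis by (auto simp: free_on_def)
qed

lemma span_tensor:
  "free_vector_space.span {tensor x y | x y. x \<in> free_on A \<and> y \<in> free_on B} = free_on (A \<times> B)"
    (is "free_vector_space.span ?T = _")
proof
  show "free_vector_space.span ?T \<subseteq> free_on (A \<times> B)"
    by (rule free_vector_space.span_minimal[OF _ subspace_free_on]) (auto intro: tensor_in_free_on)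
  show "free_on (A \<times> B) \<subseteq> free_vector_space.span ?T"
  proof
    fix z :: "'a \<times> 'b \<Rightarrow>\<^sub>0 'c" assume z: "z \<in> free_on (A \<times> B)"
    have "lin_ext basis z \<in> free_vector_space.span ?T"
      unfolding lin_ext_def
    proof (intro free_vector_space.span_sum free_vector_space.span_scale
        free_vector_space.span_base)
      fix p assume "p \<in> Poly_Mapping.keys z"
      then obtain a b where ab: "p = (a, b)" "a \<in> A" "b \<in> B"
        using z by (auto simp: free_on_def)
      have "basis p = tensor (basis a) (basis b :: 'b \<Rightarrow>\<^sub>0 'c)"
        by (simp add: ab)
      with ab show "basis p \<in> ?T"
        by (metis (mono_tags, lifting) basis_in_free_on mem_Collect_eq)
    qed
    then show "z \<in> free_vector_space.span ?T" by (simp add: basis_expansion)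
  qed
qed

lemma lin_ext_tensor: "lin_ext (\<lambda>(a, b). h a b) (tensor x y) = bilin_ext h x y"
proof -
  let ?X = "Poly_Mapping.keys x" and ?Y = "Poly_Mapping.keys y"
  have "Poly_Mapping.keys (tensor x y) \<subseteq> ?X \<times> ?Y"
    using tensor_in_free_on[of x ?X y ?Y] by (simp add: free_on_def)
  then have "lin_ext (\<lambda>(a, b). h a b) (tensor x y) =
      (\<Sum>p\<in>?X \<times> ?Y. scale (Poly_Mapping.lookup (tensor x y) p) (case p of (a, b) \<Rightarrow> h a b))"
    by (intro lin_ext_superset) auto
  also have "\<dots> = bilin_ext h x y"
    by (auto simp: sum.cartesian_product lookup_tensor bilin_ext_def lin_ext_def
        free_vector_space.scale_sum_right intro!: sum.cong)
  finally show ?thesis .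
qed

lemma tensor_universal:
  fixes h :: "('a \<Rightarrow>\<^sub>0 'k::field) \<Rightarrow> ('b \<Rightarrow>\<^sub>0 'k) \<Rightarrow> ('c \<Rightarrow>\<^sub>0 'k)"
  assumes "bilinear_on (free_on A) (free_on B) h"
  shows "\<exists>L. linear_on (free_on (A \<times> B)) L \<and>
             (\<forall>x\<in>free_on A. \<forall>y\<in>free_on B. L (tensor x y) = h x y) \<and>
             (\<forall>L'. linear_on (free_on (A \<times> B)) L' \<longrightarrow>
                (\<forall>x\<in>free_on A. \<forall>y\<in>free_on B. L' (tensor x y) = h x y) \<longrightarrow>
                (\<forall>z\<in>free_on (A \<times> B). L' z = L z))"
proof (intro exI conjI allI impI ballI)
  let ?L = "lin_ext (\<lambda>(a, b). h (basis a) (basis b))"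
  show "linear_on (free_on (A \<times> B)) ?L" by (rule linear_on_lin_ext)
  show "?L (tensor x y) = h x y" if "x \<in> free_on A" "y \<in> free_on B" for x y
    using bilinear_on_eq_bilin_ext[OF assms that] by (simp add: lin_ext_tensor)
  fix L' :: "('a \<times> 'b \<Rightarrow>\<^sub>0 'k) \<Rightarrow> ('c \<Rightarrow>\<^sub>0 'k)" and z :: "'a \<times> 'b \<Rightarrow>\<^sub>0 'k"
  assume L': "linear_on (free_on (A \<times> B)) L'"
    "\<forall>x\<in>free_on A. \<forall>y\<in>free_on B. L' (tensor x y) = h x y" and z: "z \<in> free_on (A \<times> B)"
  have eq: "L' (basis (a, b)) = h (basis a) (basis b)" if "a \<in> A" "b \<in> B" for a b
    using L'(2) that by (metis basis_in_free_on tensor_basis)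
  have "L' z = lin_ext (\<lambda>p. L' (basis p)) z"
    by (rule linear_on_eq_lin_ext[OF L'(1) z])
  also have "\<dots> = ?L z"
    unfolding lin_ext_def using z by (intro sum.cong) (auto simp: free_on_def eq)
  finally show "L' z = ?L z" .
qed

lemma tensor_map_tensor:
  assumes "linear_on (free_on A) f" "linear_on (free_on B) g" "x \<in> free_on A" "y \<in> free_on B"
  shows "tensor_map f g (tensor x y) = tensor (f x) (g y)"
proof -
  have "bilinear_on (free_on A) (free_on B) (\<lambda>x y. tensor (f x) (g y))"
    using assms(1,2) by (simp add: bilinear_on_def linear_on_def tensor_bilinear)
  from bilinear_on_eq_bilin_ext[OF this assms(3,4)] show ?thesis
    by (simp add: tensor_map_def lin_ext_tensor)
qed

lemma tensor_mult_tensor: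
  assumes m: "bilinear_on (free_on A) (free_on A) m"
    and x: "x1 \<in> free_on A" "x2 \<in> free_on A" and y: "y1 \<in> free_on A" "y2 \<in> free_on A"
  shows "tensor_mult m (tensor x1 x2) (tensor y1 y2) = tensor (m x1 y1) (m x2 y2)"
proof -
  let ?V = "free_on A"
  have "tensor_mult m (tensor x1 x2) (tensor y1 y2) =
      lin_ext (\<lambda>(a1, a2). lin_ext (\<lambda>(b1, b2).
        tensor (m (basis a1) (basis b1)) (m (basis a2) (basis b2))) (tensor y1 y2)) (tensor x1 x2)"
    by (simp add: tensor_mult_def bilin_ext_def case_prod_unfold)
  also have "\<dots> = bilin_ext (\<lambda>a1 a2. bilin_ext (\<lambda>b1 b2.
        tensor (m (basis a1) (basis b1)) (m (basis a2) (basis b2))) y1 y2) x1 x2"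
    by (simp add: lin_ext_tensor)
  also have "\<dots> = bilin_ext (\<lambda>a1 a2. tensor (m (basis a1) y1) (m (basis a2) y2)) x1 x2"
  proof -
    have "bilin_ext (\<lambda>b1 b2. tensor (m (basis a1) (basis b1)) (m (basis a2) (basis b2))) y1 y2 =
        tensor (m (basis a1) y1) (m (basis a2) y2)" if "a1 \<in> A" "a2 \<in> A" for a1 a2
    proof -
      have "bilinear_on ?V ?V (\<lambda>y1 y2. tensor (m (basis a1) y1) (m (basis a2) y2))"
        using m that by (simp add: bilinear_on_def linear_on_def tensor_bilinear)
      from bilinear_on_eq_bilin_ext[OF this y] show ?thesis by simp
    qed
    then show ?thesis
      unfolding bilin_ext_def[of _ x1 x2] lin_ext_def[of _ x1] lin_ext_def[of _ x2]
      using x by (intro sum.cong arg_cong[of _ _ "scale _"]) (auto simp: free_on_def)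
  qed
  also have "\<dots> = tensor (m x1 y1) (m x2 y2)"
  proof -
    have "bilinear_on ?V ?V (\<lambda>x1 x2. tensor (m x1 y1) (m x2 y2))"
      using m y by (simp add: bilinear_on_def linear_on_def tensor_bilinear)
    from bilinear_on_eq_bilin_ext[OF this x] show ?thesis by simp
  qed
  finally show ?thesis .
qed

lemma tensor_assoc_tensor: "tensor_assoc (tensor (tensor x y) z) = tensor x (tensor y z)"
proof (rule poly_mapping_eqI)
  have expand: "lin_ext (\<lambda>((a, b), c). basis (a, b, c)) w =
      (\<Sum>p\<in>Poly_Mapping.keys w. Poly_Mapping.single (fst (fst p), snd (fst p), snd p)
         (Poly_Mapping.lookup w p))" for w :: "('a \<times> 'b) \<times> 'c \<Rightarrow>\<^sub>0 'd"
    unfolding lin_ext_def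
    by (intro sum.cong poly_mapping_eqI) (auto simp: lookup_single when_def split: prod.splits)
  have lk: "Poly_Mapping.lookup (tensor_assoc w) (a, b, c) = Poly_Mapping.lookup w ((a, b), c)"
    for w :: "('a \<times> 'b) \<times> 'c \<Rightarrow>\<^sub>0 'd" and a b c
  proof -
    have "Poly_Mapping.lookup (tensor_assoc w) (a, b, c) = (\<Sum>p\<in>Poly_Mapping.keys w.
        if p = ((a, b), c) then Poly_Mapping.lookup w p else 0)"
      unfolding tensor_assoc_def expand lookup_sum
      by (intro sum.cong) (auto simp: lookup_single when_def)
    also have "\<dots> = Poly_Mapping.lookup w ((a, b), c)"
      by (auto simp: in_keys_iff)
    finally show ?thesis .
  qed
  fix p :: "'a \<times> 'b \<times> 'c"
  obtain a b c where "p = (a, b, c)" by (cases p)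
  then show "Poly_Mapping.lookup (tensor_assoc (tensor (tensor x y) z)) p =
      Poly_Mapping.lookup (tensor x (tensor y z)) p"
    by (simp add: lk lookup_tensor mult.assoc)
qed

section \<open>Hopf algebras\<close>

text \<open>As usual in this combinatorial setting, neither unit, counit nor antipode is part of the
  structure. The underlying vector space is \<open>free_on B\<close>.\<close>

locale hopf_algebra =
  fixes B :: "'b set"
    and mult :: "('b \<Rightarrow>\<^sub>0 'k::field) \<Rightarrow> ('b \<Rightarrow>\<^sub>0 'k) \<Rightarrow> ('b \<Rightarrow>\<^sub>0 'k)"
    and comult :: "('b \<Rightarrow>\<^sub>0 'k) \<Rightarrow> ('b \<times> 'b \<Rightarrow>\<^sub>0 'k)"
  assumes mult_closed: "\<lbrakk>x \<in> free_on B; y \<in> free_on B\<rbrakk> \<Longrightarrow> mult x y \<in> free_on B"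
    and mult_bilinear: "bilinear_on (free_on B) (free_on B) mult"
    and mult_assoc: "\<lbrakk>x \<in> free_on B; y \<in> free_on B; z \<in> free_on B\<rbrakk> \<Longrightarrow>
      mult (mult x y) z = mult x (mult y z)"
    and comult_closed: "x \<in> free_on B \<Longrightarrow> comult x \<in> free_on (B \<times> B)"
    and comult_linear: "linear_on (free_on B) comult"
    and comult_coassoc: "x \<in> free_on B \<Longrightarrow>
      tensor_assoc (tensor_map comult id (comult x)) = tensor_map id comult (comult x)"
    and comult_mult: "\<lbrakk>x \<in> free_on B; y \<in> free_on B\<rbrakk> \<Longrightarrow>
      comult (mult x y) = tensor_mult mult (comult x) (comult y)"

text \<open>The component of degree \<open>n\<close> is \<open>free_on (B n)\<close>. The component of degree \<open>n\<close> of the tensor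
  square is the direct sum of the \<open>free_on (B i) \<otimes> free_on (B (n - i))\<close> for \<open>i \<le> n\<close>.\<close>

locale graded_hopf_algebra =
  hopf_algebra "\<Union>n. B n" mult comult
  for B :: "nat \<Rightarrow> 'b set"
    and mult :: "('b \<Rightarrow>\<^sub>0 'k::field) \<Rightarrow> ('b \<Rightarrow>\<^sub>0 'k) \<Rightarrow> ('b \<Rightarrow>\<^sub>0 'k)"
    and comult :: "('b \<Rightarrow>\<^sub>0 'k) \<Rightarrow> ('b \<times> 'b \<Rightarrow>\<^sub>0 'k)" +
  assumes disjoint_degrees: "disjoint_family B"
    and mult_graded: "\<lbrakk>x \<in> free_on (B m); y \<in> free_on (B n)\<rbrakk> \<Longrightarrow> mult x y \<in> free_on (B (m + n))"
    and comult_graded: "x \<in> free_on (B n) \<Longrightarrow> comult x \<in> free_on (\<Union>i\<le>n. B i \<times> B (n - i))"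

section \<open>Decoration sets\<close>

text \<open>\<open>nth_elem R s\<close> is \<open>r\<^sub>s\<close> for \<open>R = {r\<^sub>1 < \<dots> < r\<^sub>q}\<close>.\<close>

definition nth_elem :: "nat set \<Rightarrow> nat \<Rightarrow> nat" where
  "nth_elem R s = sorted_list_of_set R ! (s - 1)"

locale decoration_set =
  fixes X :: "nat \<Rightarrow> 'x set"
    and conc :: "'x \<Rightarrow> 'x \<Rightarrow> 'x"
    and select :: "'x \<Rightarrow> nat set \<Rightarrow> 'x"
  assumes disjoint_sizes: "disjoint_family X"
    and conc_closed: "\<lbrakk>x \<in> X m; y \<in> X n\<rbrakk> \<Longrightarrow> conc x y \<in> X (m + n)"
    and select_closed: "\<lbrakk>x \<in> X m; R \<subseteq> {1..m}; card R = k\<rbrakk> \<Longrightarrow> select x R \<in> X k"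
    and conc_assoc: "\<lbrakk>x \<in> X m; y \<in> X n; z \<in> X p\<rbrakk> \<Longrightarrow>
      conc x (conc y z) = conc (conc x y) z"
    and select_select: "\<lbrakk>x \<in> X p; R \<subseteq> {1..p}; S \<subseteq> {1..card R}\<rbrakk> \<Longrightarrow>
      select (select x R) S = select x (nth_elem R ` S)"
    and conc_select: "\<lbrakk>x \<in> X m; y \<in> X n; R \<subseteq> {1..m}; S \<subseteq> {1..n}\<rbrakk> \<Longrightarrow>
      conc (select x R) (select y S) = select (conc x y) (R \<union> (\<lambda>s. s + m) ` S)"

section \<open>Decorated permutations\<close>

text \<open>Permutations of \<open>{1..n}\<close> are lists of length \<open>n\<close> (one-line notation), with positions and
  values counted from 1.\<close>

abbreviation perms :: "nat \<Rightarrow> nat list set" where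
  "perms n \<equiv> permutations_of_set {1..n}"

definition standardize :: "nat list \<Rightarrow> nat list" where
  "standardize w = map (\<lambda>v. card {u \<in> set w. u \<le> v}) w"

definition stdp :: "nat list \<Rightarrow> nat set \<Rightarrow> nat list" where
  "stdp \<rho> R = standardize (nths \<rho> {i. Suc i \<in> R})"

definition stdv :: "nat list \<Rightarrow> nat set \<Rightarrow> nat list" where
  "stdv \<rho> R = standardize (filter (\<lambda>v. v \<in> R) \<rho>)"

definition shifted_shuffle :: "nat list \<Rightarrow> nat list \<Rightarrow> nat list set" where
  "shifted_shuffle \<sigma> \<tau> =
     (let m = length \<sigma>; n = length \<tau>
      in {\<rho> \<in> perms (m + n). stdv \<rho> {1..m} = \<sigma> \<and> stdv \<rho> ({1..m + n} - {1..m}) = \<tau>})"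

definition decorated_perms :: "(nat \<Rightarrow> 'x set) \<Rightarrow> nat \<Rightarrow> (nat list \<times> 'x) set" where
  "decorated_perms X n = perms n \<times> X n"

definition std_decorated ::
  "('x \<Rightarrow> nat set \<Rightarrow> 'x) \<Rightarrow> nat list \<times> 'x \<Rightarrow> nat set \<Rightarrow> nat list \<times> 'x" where
  "std_decorated select = (\<lambda>(\<rho>, z) R. (stdp \<rho> R, select z ((\<lambda>i. \<rho> ! (i - 1)) ` R)))"

definition dp_mult ::
  "('x \<Rightarrow> 'x \<Rightarrow> 'x) \<Rightarrow>
   (nat list \<times> 'x \<Rightarrow>\<^sub>0 'k::field) \<Rightarrow> (nat list \<times> 'x \<Rightarrow>\<^sub>0 'k) \<Rightarrow> (nat list \<times> 'x \<Rightarrow>\<^sub>0 'k)" where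
  "dp_mult conc = bilin_ext (\<lambda>(\<sigma>, x) (\<tau>, y). \<Sum>\<rho>\<in>shifted_shuffle \<sigma> \<tau>. basis (\<rho>, conc x y))"

definition dp_comult ::
  "('x \<Rightarrow> nat set \<Rightarrow> 'x) \<Rightarrow>
   (nat list \<times> 'x \<Rightarrow>\<^sub>0 'k::field) \<Rightarrow> ((nat list \<times> 'x) \<times> (nat list \<times> 'x) \<Rightarrow>\<^sub>0 'k)" where
  "dp_comult select = lin_ext (\<lambda>(\<rho>, z). \<Sum>k\<le>length \<rho>.
     tensor (basis (std_decorated select (\<rho>, z) {1..k}))
            (basis (std_decorated select (\<rho>, z) ({1..length \<rho>} - {1..k}))))"

end

theory Submission
  imports Defs
begin

text \<open>
  Every axiom is multilinear, so it suffices to verify it on basis elements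
  (\<open>graded_hopf_algebra_basisI\<close>). There, the proof replaces decorated permutations by words that
  need not be standardized. A word \<open>w\<close> with distinct letters in \<open>{1..p}\<close> and a decoration \<open>z\<close> of size
  \<open>p\<close> determine the decorated permutation \<open>(standardize w, select z (set w))\<close>, written
  \<open>std_word select z w\<close>, or \<open>pack z w\<close> inside the locale. In these terms both operations become
  operations on words that keep the ambient decoration:

  \<^item> The coproduct of \<open>pack z w\<close> is the sum over all factorizations \<open>w = w\<^sub>1 @ w\<^sub>2\<close> of
    \<open>pack z w\<^sub>1 \<otimes> pack z w\<^sub>2\<close> (\<open>dp_comult_pack\<close>). Standardizing and selecting in two steps is the
    same as doing it in one step, which for the decorations is the axiom \<open>select_select\<close>.

  \<^item> The product of \<open>pack x u\<close> and \<open>pack y v\<close> is the sum of \<open>pack (conc x y) w\<close> over the shuffles \<open>w\<close>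
    of \<open>u\<close> and the shifted word \<open>v\<close> (\<open>dp_mult_pack\<close>). Standardization maps these shuffles
    bijectively onto those that define the product (\<open>standardize_shuffles\<close>), and the decorations
    agree by the axiom \<open>conc_select\<close>.

  What remains are facts about words. Coassociativity says that cutting a word into three factors
  can be done in either order (\<open>sum_deconcatenate_twice\<close>). Associativity follows from \<open>conc_assoc\<close> and
  from the associativity of shuffling words with disjoint alphabets (\<open>sum_shuffles_assoc\<close>). The
  compatibility of product and coproduct says that cutting a shuffle of \<open>a\<close> and \<open>b\<close> is the same as
  cutting \<open>a\<close> and \<open>b\<close> and shuffling the left factors and the right factors
  (\<open>sum_shuffles_deconcatenate\<close>). The disjointness of the alphabets ensures that these two
  regroupings of shuffles count each word once, since its constituents are recovered by filtering.
\<close>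

section \<open>Linear extension from a basis\<close>

lemma lin_ext_sum: "lin_ext f (\<Sum>i\<in>I. x i) = (\<Sum>i\<in>I. lin_ext f (x i))"
  using linear_on_sum[OF linear_on_lin_ext[of "free_on UNIV" f], of I x] by (simp add: free_on_def)

lemma lin_ext_cong:
  assumes "x \<in> free_on A" "\<And>a. a \<in> A \<Longrightarrow> f a = g a"
  shows "lin_ext f x = lin_ext g x"
  unfolding lin_ext_def using assms by (intro sum.cong) (auto simp: free_on_def)

lemma linear_on_eqI:
  assumes "linear_on (free_on A) f" "linear_on (free_on A) g"
    and "\<And>a. a \<in> A \<Longrightarrow> f (basis a) = g (basis a)" and "x \<in> free_on A"
  shows "f x = g x"
  unfolding linear_on_eq_lin_ext[OF assms(1,4)] linear_on_eq_lin_ext[OF assms(2,4)]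
  by (rule lin_ext_cong[OF assms(4,3)])

lemma lin_ext_in_free_on:
  assumes "x \<in> free_on A" "\<And>a. a \<in> A \<Longrightarrow> f a \<in> free_on C"
  shows "lin_ext f x \<in> free_on C"
  unfolding lin_ext_def using assms
  by (intro free_on_sum free_on_scale) (auto simp: free_on_def)

lemma bilin_ext_in_free_on:
  assumes "x \<in> free_on A" "y \<in> free_on B" "\<And>a b. a \<in> A \<Longrightarrow> b \<in> B \<Longrightarrow> h a b \<in> free_on C"
  shows "bilin_ext h x y \<in> free_on C"
  unfolding bilin_ext_def using assms by (intro lin_ext_in_free_on) auto

lemma bilin_ext_sum_left: "bilin_ext h (\<Sum>i\<in>I. x i) y = (\<Sum>i\<in>I. bilin_ext h (x i) y)"
  by (simp add: bilin_ext_def lin_ext_sum)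

lemma linear_on_bilin_ext_left: "linear_on V (\<lambda>x. bilin_ext h x y)"
  and linear_on_bilin_ext_right: "linear_on W (bilin_ext h z)"
  using bilinear_on_bilin_ext[of V UNIV h] bilinear_on_bilin_ext[of UNIV W h]
  by (auto simp: bilinear_on_def)

lemma bilin_ext_sum_right: "bilin_ext h x (\<Sum>i\<in>I. y i) = (\<Sum>i\<in>I. bilin_ext h x (y i))"
  using linear_on_sum[OF linear_on_bilin_ext_right[of "free_on UNIV" h x], of I y]
  by (simp add: free_on_def)

lemma bilin_ext_sum:
  "bilin_ext h (\<Sum>i\<in>I. x i) (\<Sum>j\<in>J. y j) = (\<Sum>i\<in>I. \<Sum>j\<in>J. bilin_ext h (x i) (y j))"
  by (subst bilin_ext_sum_left) (simp only: bilin_ext_sum_right)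

lemma tensor_sum_left: "tensor (\<Sum>i\<in>I. x i) y = (\<Sum>i\<in>I. tensor (x i) y)"
  and tensor_sum_right: "tensor u (\<Sum>j\<in>J. z j) = (\<Sum>j\<in>J. tensor u (z j))"
  by (simp_all add: tensor_def bilin_ext_sum_left bilin_ext_sum_right)

lemma tensor_sum: "tensor (\<Sum>i\<in>I. x i) (\<Sum>j\<in>J. z j) = (\<Sum>i\<in>I. \<Sum>j\<in>J. tensor (x i) (z j))"
  unfolding tensor_def by (rule bilin_ext_sum)

lemma linear_on_compose:
  assumes "linear_on UNIV g" "linear_on V f"
  shows "linear_on V (\<lambda>x. g (f x))"
  using assms by (simp add: linear_on_def)

text \<open>Both sides of each identity are multilinear, so that one argument after the other can be
  replaced by basis elements. Gradedness on basis elements also yields closure, since the total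
  space is spanned by the homogeneous basis elements.\<close>

lemma graded_hopf_algebra_basisI:
  fixes B :: "nat \<Rightarrow> 'b set" and h :: "'b \<Rightarrow> 'b \<Rightarrow> ('b \<Rightarrow>\<^sub>0 'k::field)"
    and d :: "'b \<Rightarrow> ('b \<times> 'b \<Rightarrow>\<^sub>0 'k)"
  assumes disj: "disjoint_family B"
    and h_graded: "\<And>m n a b. a \<in> B m \<Longrightarrow> b \<in> B n \<Longrightarrow> h a b \<in> free_on (B (m + n))"
    and d_graded: "\<And>n a. a \<in> B n \<Longrightarrow> d a \<in> free_on (\<Union>i\<le>n. B i \<times> B (n - i))"
    and assoc: "\<And>l m n a b c. a \<in> B l \<Longrightarrow> b \<in> B m \<Longrightarrow> c \<in> B n \<Longrightarrow>
      bilin_ext h (h a b) (basis c) = bilin_ext h (basis a) (h b c)"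
    and coassoc: "\<And>n a. a \<in> B n \<Longrightarrow>
      tensor_assoc (tensor_map (lin_ext d) id (d a)) = tensor_map id (lin_ext d) (d a)"
    and compat: "\<And>m n a b. a \<in> B m \<Longrightarrow> b \<in> B n \<Longrightarrow>
      lin_ext d (h a b) = tensor_mult (bilin_ext h) (d a) (d b)"
  shows "graded_hopf_algebra B (bilin_ext h) (lin_ext d)"
proof -
  let ?B = "\<Union>n. B n" and ?M = "bilin_ext h" and ?D = "lin_ext d"
  have up: "x \<in> free_on C" if "x \<in> free_on A" "A \<subseteq> C" for x :: "'c \<Rightarrow>\<^sub>0 'k" and A C
    using that by (auto simp: free_on_def)
  show ?thesis
  proof unfold_locales
    show "?M x y \<in> free_on ?B" if "x \<in> free_on ?B" "y \<in> free_on ?B" for x y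
      by (rule bilin_ext_in_free_on[OF that]) (auto intro: up[OF h_graded])
    show "bilinear_on (free_on ?B) (free_on ?B) ?M" by (rule bilinear_on_bilin_ext)
    show "?M (?M x y) z = ?M x (?M y z)"
      if x: "x \<in> free_on ?B" and y: "y \<in> free_on ?B" and z: "z \<in> free_on ?B" for x y z
    proof -
      have 1: "?M (?M (basis a) (basis b)) z = ?M (basis a) (?M (basis b) z)"
        if "a \<in> ?B" "b \<in> ?B" for a b
        by (rule linear_on_eqI[OF _ _ _ z])
          (use that assoc in \<open>auto intro: linear_on_bilin_ext_right
            linear_on_compose[OF linear_on_bilin_ext_right linear_on_bilin_ext_right]\<close>)
      have 2: "?M (?M (basis a) y) z = ?M (basis a) (?M y z)" if "a \<in> ?B" for a
        by (rule linear_on_eqI[OF _ _ _ y])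
          (use that 1 in \<open>auto intro:
            linear_on_compose[OF linear_on_bilin_ext_left linear_on_bilin_ext_right]
            linear_on_compose[OF linear_on_bilin_ext_right linear_on_bilin_ext_left]\<close>)
      show ?thesis
        by (rule linear_on_eqI[OF _ _ _ x])
          (use 2 in \<open>auto intro: linear_on_bilin_ext_left
            linear_on_compose[OF linear_on_bilin_ext_left linear_on_bilin_ext_left]\<close>)
    qed
    show "?D x \<in> free_on (?B \<times> ?B)" if "x \<in> free_on ?B" for x
      by (rule lin_ext_in_free_on[OF that]) (auto intro!: up[OF d_graded])
    show "linear_on (free_on ?B) ?D" by (rule linear_on_lin_ext)
    show "tensor_assoc (tensor_map ?D id (?D x)) = tensor_map id ?D (?D x)"
      if "x \<in> free_on ?B" for x
      by (rule linear_on_eqI[OF _ _ _ that])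
        (use coassoc in \<open>auto simp: tensor_map_def tensor_assoc_def intro!: linear_on_lin_ext
          linear_on_compose[OF linear_on_lin_ext linear_on_lin_ext]
          linear_on_compose[OF linear_on_lin_ext
            linear_on_compose[OF linear_on_lin_ext linear_on_lin_ext]]\<close>)
    show "?D (?M x y) = tensor_mult ?M (?D x) (?D y)"
      if x: "x \<in> free_on ?B" and y: "y \<in> free_on ?B" for x y
    proof -
      have 1: "?D (?M (basis a) y) = tensor_mult ?M (?D (basis a)) (?D y)" if "a \<in> ?B" for a
        unfolding tensor_mult_def
        by (rule linear_on_eqI[OF _ _ _ y])
          (use that compat in \<open>auto simp: tensor_mult_def intro:
            linear_on_compose[OF linear_on_lin_ext linear_on_bilin_ext_right]
            linear_on_compose[OF linear_on_bilin_ext_right linear_on_lin_ext]\<close>)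
      show ?thesis
        unfolding tensor_mult_def
        by (rule linear_on_eqI[OF _ _ _ x])
          (use 1 in \<open>auto simp: tensor_mult_def intro:
            linear_on_compose[OF linear_on_lin_ext linear_on_bilin_ext_left]
            linear_on_compose[OF linear_on_bilin_ext_left linear_on_lin_ext]\<close>)
    qed
    show "disjoint_family B" by (rule disj)
    show "?M x y \<in> free_on (B (m + n))" if "x \<in> free_on (B m)" "y \<in> free_on (B n)" for x y m n
      by (rule bilin_ext_in_free_on[OF that h_graded])
    show "?D x \<in> free_on (\<Union>i\<le>n. B i \<times> B (n - i))" if "x \<in> free_on (B n)" for x n
      by (rule lin_ext_in_free_on[OF that d_graded])
  qed
qed

section \<open>Shuffling and cutting words\<close>

lemma in_shuffles_iff_filter:
  assumes "\<And>x. x \<in> set a \<Longrightarrow> P x" "\<And>y. y \<in> set b \<Longrightarrow> \<not> P y"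
  shows "w \<in> shuffles a b \<longleftrightarrow> filter P w = a \<and> filter (\<lambda>x. \<not> P x) w = b"
  using inv_image_partition[of a P b] assms by (auto simp: o_def vimage_def)

lemma shuffles_map: "shuffles (map f xs) (map f ys) = map f ` shuffles xs ys"
  by (induction xs ys rule: shuffles.induct) (auto simp: image_Un image_image)

text \<open>Both sides consist of the shuffles of the three words: the first letter of such a shuffle is
  the first letter of \<open>a\<close>, of \<open>b\<close> or of \<open>c\<close>, and the rest is a shuffle of what remains.\<close>

lemma shuffles_assoc:
  "(\<Union>u\<in>shuffles a b. shuffles u c) = (\<Union>v\<in>shuffles b c. shuffles a v)"
proof -
  have "(\<exists>u\<in>shuffles a b. w \<in> shuffles u c) \<longleftrightarrow> (\<exists>v\<in>shuffles b c. w \<in> shuffles a v)" for w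
  proof (induction w arbitrary: a b c)
    case Nil
    then show ?case by auto
  next
    case (Cons x w)
    have head: "(\<exists>u\<in>U. u \<noteq> [] \<and> hd u = x \<and> Q (tl u)) \<longleftrightarrow> (\<exists>u. x # u \<in> U \<and> Q u)"
      for U :: "'a list set" and Q
      by (metis list.collapse list.distinct(1) list.sel(1,3))
    have left: "(\<exists>u\<in>shuffles a b. x # w \<in> shuffles u c) \<longleftrightarrow>
      (a \<noteq> [] \<and> hd a = x \<and> (\<exists>u\<in>shuffles (tl a) b. w \<in> shuffles u c)) \<or>
      (b \<noteq> [] \<and> hd b = x \<and> (\<exists>u\<in>shuffles a (tl b). w \<in> shuffles u c)) \<or>
      (c \<noteq> [] \<and> hd c = x \<and> (\<exists>u\<in>shuffles a b. w \<in> shuffles u (tl c)))"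
      using head[of "shuffles a b" "\<lambda>u. w \<in> shuffles u c"]
      unfolding Cons_in_shuffles_iff by blast
    have right: "(\<exists>v\<in>shuffles b c. x # w \<in> shuffles a v) \<longleftrightarrow>
      (a \<noteq> [] \<and> hd a = x \<and> (\<exists>v\<in>shuffles b c. w \<in> shuffles (tl a) v)) \<or>
      (b \<noteq> [] \<and> hd b = x \<and> (\<exists>v\<in>shuffles (tl b) c. w \<in> shuffles a v)) \<or>
      (c \<noteq> [] \<and> hd c = x \<and> (\<exists>v\<in>shuffles b (tl c). w \<in> shuffles a v))"
      using head[of "shuffles b c" "\<lambda>v. w \<in> shuffles a v"]
      unfolding Cons_in_shuffles_iff by blast
    show ?case unfolding left right by (simp only: Cons.IH)
  qed
  then show ?thesis by blast
qed

text \<open>As sets, both sides range over the shuffles of the three words. Disjointness of the alphabets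
  rules out multiplicities: the intermediate shuffle is recovered from \<open>w\<close> by deleting the letters of
  the word that is shuffled in last.\<close>

lemma sum_shuffles_assoc:
  assumes "set a \<inter> set b = {}" "set a \<inter> set c = {}" "set b \<inter> set c = {}"
  shows "(\<Sum>u\<in>shuffles a b. \<Sum>w\<in>shuffles u c. g w) = (\<Sum>v\<in>shuffles b c. \<Sum>w\<in>shuffles a v. g w)"
proof -
  have left: "filter (\<lambda>x. x \<notin> set c) w = u" if "u \<in> shuffles a b" "w \<in> shuffles u c" for u w
    using that assms set_shuffles[OF that(1)] by (intro filter_shuffles_disjoint2) auto
  have right: "filter (\<lambda>x. x \<notin> set a) w = v" if "v \<in> shuffles b c" "w \<in> shuffles a v" for v w
    using that assms set_shuffles[OF that(1)] by (intro filter_shuffles_disjoint1) auto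
  have "(\<Sum>u\<in>shuffles a b. \<Sum>w\<in>shuffles u c. g w) = sum g (\<Union>u\<in>shuffles a b. shuffles u c)"
    using left by (intro sum.UNION_disjoint[symmetric]) blast+
  also have "\<dots> = sum g (\<Union>v\<in>shuffles b c. shuffles a v)"
    by (simp only: shuffles_assoc)
  also have "\<dots> = (\<Sum>v\<in>shuffles b c. \<Sum>w\<in>shuffles a v. g w)"
    using right by (intro sum.UNION_disjoint) blast+
  finally show ?thesis .
qed

text \<open>Both sides sum \<open>g u v\<close> over the pairs with \<open>u @ v \<in> shuffles a b\<close>. On the left, the cut position
  is the length of \<open>u\<close>. On the right, \<open>i\<close> and \<open>j\<close> count the letters of \<open>u\<close> that come from \<open>a\<close> and
  from \<open>b\<close>; since the alphabets are disjoint, they are determined by \<open>u\<close>.\<close>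

lemma sum_shuffles_deconcatenate:
  assumes disj: "set a \<inter> set b = {}"
  shows "(\<Sum>w\<in>shuffles a b. \<Sum>k\<le>length w. g (take k w) (drop k w)) =
    (\<Sum>i\<le>length a. \<Sum>j\<le>length b. \<Sum>u\<in>shuffles (take i a) (take j b).
       \<Sum>v\<in>shuffles (drop i a) (drop j b). g u v)"
proof -
  let ?P = "\<lambda>x. x \<in> set a"
  let ?T = "{(u, v). u @ v \<in> shuffles a b}"
  have pieces: "u \<in> shuffles (take i a) (take j b) \<longleftrightarrow>
      filter ?P u = take i a \<and> filter (\<lambda>x. \<not> ?P x) u = take j b"
    "v \<in> shuffles (drop i a) (drop j b) \<longleftrightarrow>
      filter ?P v = drop i a \<and> filter (\<lambda>x. \<not> ?P x) v = drop j b" for i j u v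
    using disj by (intro in_shuffles_iff_filter; auto dest: in_set_takeD in_set_dropD)+
  have whole: "w \<in> shuffles a b \<longleftrightarrow> filter ?P w = a \<and> filter (\<lambda>x. \<not> ?P x) w = b" for w
    using disj by (intro in_shuffles_iff_filter) auto
  have "(\<Sum>w\<in>shuffles a b. \<Sum>k\<le>length w. g (take k w) (drop k w)) =
      (\<Sum>(w, k)\<in>(SIGMA w:shuffles a b. {..length w}). g (take k w) (drop k w))"
    by (simp add: sum.Sigma)
  also have "\<dots> = (\<Sum>(u, v)\<in>?T. g u v)"
    by (rule sum.reindex_bij_witness[of _ "\<lambda>(u, v). (u @ v, length u)"
          "\<lambda>(w, k). (take k w, drop k w)"]) auto
  also have "\<dots> = (\<Sum>(i, j, u, v)\<in>(SIGMA i:{..length a}. SIGMA j:{..length b}.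
      shuffles (take i a) (take j b) \<times> shuffles (drop i a) (drop j b)). g u v)"
  proof (rule sum.reindex_bij_witness[of _ "\<lambda>(i, j, u, v). (u, v)"
        "\<lambda>(u, v). (length (filter ?P u), length (filter (\<lambda>x. \<not> ?P x) u), u, v)"],
      goal_cases)
    case (1 p)
    then show ?case by auto
  next
    case (2 p)
    obtain u v where p: "p = (u, v)" by (cases p)
    from 2 have "a = filter ?P u @ filter ?P v"
      "b = filter (\<lambda>x. \<not> ?P x) u @ filter (\<lambda>x. \<not> ?P x) v"
      by (auto simp: p whole)
    then have "take (length (filter ?P u)) a = filter ?P u"
      "drop (length (filter ?P u)) a = filter ?P v" "length (filter ?P u) \<le> length a"
      "take (length (filter (\<lambda>x. \<not> ?P x) u)) b = filter (\<lambda>x. \<not> ?P x) u"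
      "drop (length (filter (\<lambda>x. \<not> ?P x) u)) b = filter (\<lambda>x. \<not> ?P x) v"
      "length (filter (\<lambda>x. \<not> ?P x) u) \<le> length b"
      by (metis append_eq_conv_conj length_append le_add1)+
    then show ?case by (simp add: p pieces partition_in_shuffles)
  next
    case (3 p)
    then show ?case by (auto simp: pieces)
  next
    case (4 p)
    then show ?case by (auto simp: pieces whole)
  next
    case (5 p)
    then show ?case by auto
  qed
  also have "\<dots> = (\<Sum>i\<le>length a. \<Sum>j\<le>length b. \<Sum>u\<in>shuffles (take i a) (take j b).
       \<Sum>v\<in>shuffles (drop i a) (drop j b). g u v)"
    by (simp add: sum.Sigma sum.cartesian_product case_prod_unfold)
  finally show ?thesis .
qed

text \<open>Both sides range over the factorizations of \<open>w\<close> into three factors, with cuts at \<open>j\<close> and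
  \<open>k = i + j\<close>.\<close>

lemma sum_deconcatenate_twice:
  "(\<Sum>k\<le>length w. \<Sum>j\<le>k. g (take j w) (drop j (take k w)) (drop k w)) =
   (\<Sum>j\<le>length w. \<Sum>i\<le>length w - j. g (take j w) (take i (drop j w)) (drop i (drop j w)))"
proof -
  have "(\<Sum>k\<le>length w. \<Sum>j\<le>k. g (take j w) (drop j (take k w)) (drop k w)) =
      (\<Sum>(k, j)\<in>(SIGMA k:{..length w}. {..k}). g (take j w) (drop j (take k w)) (drop k w))"
    by (simp add: sum.Sigma)
  also have "\<dots> = (\<Sum>(j, i)\<in>(SIGMA j:{..length w}. {..length w - j}).
      g (take j w) (take i (drop j w)) (drop i (drop j w)))"
    by (rule sum.reindex_bij_witness[of _ "\<lambda>(j, i). (i + j, j)" "\<lambda>(k, j). (j, k - j)"])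
      (auto simp: drop_take)
  also have "\<dots> = (\<Sum>j\<le>length w. \<Sum>i\<le>length w - j.
      g (take j w) (take i (drop j w)) (drop i (drop j w)))"
    by (simp add: sum.Sigma)
  finally show ?thesis .
qed

section \<open>Standardization\<close>

text \<open>For \<open>v \<in> A\<close> this is the position of \<open>v\<close> in the increasing enumeration of \<open>A\<close>, counted from 1.\<close>

definition rank :: "nat set \<Rightarrow> nat \<Rightarrow> nat" where
  "rank A v = card {u \<in> A. u \<le> v}"

lemma standardize_eq_map_rank: "standardize w = map (rank (set w)) w"
  by (simp add: standardize_def rank_def)

lemma nth_elem_rank:
  assumes "finite A" "v \<in> A"
  shows "nth_elem A (rank A v) = v"
proof -
  let ?xs = "sorted_list_of_set A"
  obtain i where i: "i < length ?xs" "v = ?xs ! i"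
    using assms by (metis in_set_conv_nth sorted_list_of_set.set_sorted_key_list_of_set)
  have sd: "sorted_wrt (<) ?xs" by simp
  have mono: "?xs ! j \<le> ?xs ! i \<longleftrightarrow> j \<le> i" if "j < length ?xs" for j
    using that i(1) sorted_wrt_nth_less[OF sd] by (metis leD leI order.order_iff_strict)
  have A: "u \<in> A \<longleftrightarrow> (\<exists>j<length ?xs. u = ?xs ! j)" for u
    using assms(1) by (metis in_set_conv_nth sorted_list_of_set.set_sorted_key_list_of_set)
  have "u \<in> A \<and> u \<le> v \<longleftrightarrow> (\<exists>j\<le>i. u = ?xs ! j)" for u
  proof -
    have "j < length ?xs \<and> ?xs ! j \<le> ?xs ! i \<longleftrightarrow> j \<le> i" for j
      using mono[of j] i(1) by linarith
    then show ?thesis unfolding A i(2) by blast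
  qed
  then have "{u \<in> A. u \<le> v} = (!) ?xs ` {..i}" by auto
  then have "rank A v = card ((!) ?xs ` {..i})" by (simp add: rank_def)
  also have "\<dots> = Suc i"
    using i(1) by (subst card_image) (auto intro!: inj_on_nth)
  finally show ?thesis by (simp add: nth_elem_def i(2))
qed

lemma strict_mono_on_rank:
  assumes "finite A"
  shows "strict_mono_on A (rank A)"
proof (rule strict_mono_onI)
  fix r s assume "r \<in> A" "s \<in> A" "r < s"
  then have "{u \<in> A. u \<le> r} \<subseteq> {u \<in> A. u \<le> s}"
    and "s \<in> {u \<in> A. u \<le> s}" "s \<notin> {u \<in> A. u \<le> r}" by auto
  then have "{u \<in> A. u \<le> r} \<subset> {u \<in> A. u \<le> s}" by blast
  then show "rank A r < rank A s"
    using assms unfolding rank_def by (intro psubset_card_mono) auto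
qed

lemma inj_on_rank: "finite A \<Longrightarrow> inj_on (rank A) A"
  by (intro strict_mono_on_imp_inj_on strict_mono_on_rank)

lemma rank_image:
  assumes "finite A"
  shows "rank A ` A = {1..card A}"
proof (rule card_subset_eq)
  show "rank A ` A \<subseteq> {1..card A}"
    using assms by (auto simp: rank_def Suc_le_eq card_gt_0_iff intro: card_mono)
  show "card (rank A ` A) = card {1..card A}"
    using card_image[OF inj_on_rank[OF assms]] by simp
qed simp

lemma standardize_in_perms:
  assumes "distinct w"
  shows "standardize w \<in> perms (length w)"
  using assms rank_image[of "set w"] inj_on_rank[of "set w"]
  by (intro permutations_of_setI)
    (simp_all add: standardize_eq_map_rank distinct_map distinct_card)

lemma standardize_map:
  assumes "strict_mono_on (set w) f"
  shows "standardize (map f w) = standardize w"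
proof -
  have inj: "inj_on f (set w)" using assms by (rule strict_mono_on_imp_inj_on)
  have "{u \<in> f ` set w. u \<le> f v} = f ` {u \<in> set w. u \<le> v}" if "v \<in> set w" for v
    using that strict_mono_on_less_eq[OF assms] by auto
  then show ?thesis
    using inj by (auto simp: standardize_def intro!: card_image inj_on_subset[OF inj])
qed

lemma standardize_perm:
  assumes "w \<in> perms n"
  shows "standardize w = w"
proof -
  have "rank {1..n} v = v" if "v \<in> {1..n}" for v
  proof -
    have "{u \<in> {1..n}. u \<le> v} = {1..v}" using that by auto
    then show ?thesis by (simp add: rank_def)
  qed
  then show ?thesis
    using permutations_of_setD(1)[OF assms] by (auto simp: standardize_eq_map_rank intro: map_idI)
qed

lemma length_perm: "w \<in> perms n \<Longrightarrow> length w = n"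
  using length_finite_permutations_of_set by fastforce

lemma shuffles_in_perms:
  assumes "\<sigma> \<in> perms m" "\<tau> \<in> perms n" "\<rho> \<in> shuffles \<sigma> (map (\<lambda>v. v + m) \<tau>)"
  shows "\<rho> \<in> perms (m + n)"
proof (rule permutations_of_setI)
  note setD = permutations_of_setD(1) and distinctD = permutations_of_setD(2)
  have "{1..m} \<union> (\<lambda>v. v + m) ` {1..n} = {1..m + n}"
    by (simp add: image_add_atLeastAtMost') auto
  then show "set \<rho> = {1..m + n}"
    using set_shuffles[OF assms(3)] setD[OF assms(1)] setD[OF assms(2)] by simp
  show "distinct \<rho>"
    by (rule distinct_disjoint_shuffles[OF _ _ _ assms(3)])
      (use distinctD[OF assms(1)] distinctD[OF assms(2)] setD[OF assms(1)] setD[OF assms(2)]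
        in \<open>auto simp: distinct_map\<close>)
qed

text \<open>The values of \<open>\<rho>\<close> in \<open>{1..m}\<close> already form a permutation, and those above \<open>m\<close> become one after
  subtracting \<open>m\<close>. So \<open>stdv\<close> only filters and shifts, and a word is a shuffle of two words with
  disjoint alphabets iff filtering recovers both of them.\<close>

lemma shifted_shuffle_eq_shuffles:
  assumes \<sigma>: "\<sigma> \<in> perms m" and \<tau>: "\<tau> \<in> perms n"
  shows "shifted_shuffle \<sigma> \<tau> = shuffles \<sigma> (map (\<lambda>v. v + m) \<tau>)"
proof -
  note setD = permutations_of_setD(1) and distinctD = permutations_of_setD(2)
  let ?sh = "map (\<lambda>v. v + m)"
  have shuf: "\<rho> \<in> shuffles \<sigma> (?sh \<tau>) \<longleftrightarrow>
      filter (\<lambda>v. v \<le> m) \<rho> = \<sigma> \<and> filter (\<lambda>v. \<not> v \<le> m) \<rho> = ?sh \<tau>" for \<rho>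
    using setD[OF \<sigma>] setD[OF \<tau>] by (intro in_shuffles_iff_filter) auto
  have stdv: "stdv \<rho> {1..m} = \<sigma> \<and> stdv \<rho> ({1..m + n} - {1..m}) = \<tau> \<longleftrightarrow>
      \<rho> \<in> shuffles \<sigma> (?sh \<tau>)" if \<rho>: "\<rho> \<in> perms (m + n)" for \<rho>
  proof -
    let ?lo = "filter (\<lambda>v. v \<le> m) \<rho>" and ?hi = "filter (\<lambda>v. \<not> v \<le> m) \<rho>"
    define w where "w = map (\<lambda>v. v - m) ?hi"
    have hi: "?hi = ?sh w" by (auto simp: w_def o_def intro!: map_idI[symmetric])
    have "?lo \<in> perms m"
      using setD[OF \<rho>] distinctD[OF \<rho>] by (intro permutations_of_setI) auto
    moreover have "filter (\<lambda>v. v \<in> {1..m}) \<rho> = ?lo"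
      using setD[OF \<rho>] by (intro filter_cong) auto
    ultimately have lo: "stdv \<rho> {1..m} = ?lo" by (simp add: stdv_def standardize_perm)
    have "(\<lambda>v. v - m) ` {v \<in> {1..m + n}. \<not> v \<le> m} = {1..n}"
    proof -
      have "v \<in> (\<lambda>v. v - m) ` {v \<in> {1..m + n}. \<not> v \<le> m}" if "v \<in> {1..n}" for v
        using that by (intro image_eqI[of _ _ "v + m"]) auto
      then show ?thesis by auto
    qed
    then have "w \<in> perms n"
      using setD[OF \<rho>] distinctD[OF \<rho>]
      by (intro permutations_of_setI) (auto simp: w_def distinct_map inj_on_def)
    then have w: "standardize (?sh w) = w"
      by (subst standardize_map) (auto simp: standardize_perm strict_mono_on_def)
    have "filter (\<lambda>v. v \<in> {1..m + n} - {1..m}) \<rho> = ?hi"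
      using setD[OF \<rho>] by (intro filter_cong) auto
    then have "stdv \<rho> ({1..m + n} - {1..m}) = w" using w hi by (simp add: stdv_def)
    moreover have "w = \<tau> \<longleftrightarrow> ?hi = ?sh \<tau>"
      unfolding hi by (rule inj_map_eq_map[symmetric]) (simp add: inj_def)
    ultimately show ?thesis using lo shuf by simp
  qed
  show ?thesis
    using stdv shuffles_in_perms[OF assms]
    by (auto simp: shifted_shuffle_def Let_def length_perm[OF \<sigma>] length_perm[OF \<tau>])
qed

text \<open>Every shuffle of \<open>u\<close> and \<open>v'\<close> has the letters \<open>set u \<union> set v'\<close>, so that one and the same
  relabelling standardizes all of them. The letters of \<open>u\<close> lie below those of \<open>v'\<close>; therefore this
  relabelling standardizes \<open>u\<close>, and it standardizes \<open>v'\<close> up to a shift by \<open>length u\<close>.\<close>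

lemma standardize_shuffles:
  assumes u: "distinct u" "set u \<subseteq> {1..m}" and v: "set v \<subseteq> {1..n}"
  defines "v' \<equiv> map (\<lambda>i. i + m) v"
  shows "bij_betw standardize (shuffles u v')
    (shuffles (standardize u) (map (\<lambda>i. i + length u) (standardize v)))"
proof -
  let ?C = "set u \<union> set v'"
  have std: "standardize w = map (rank ?C) w" if "w \<in> shuffles u v'" for w
    using set_shuffles[OF that] by (simp add: standardize_eq_map_rank)
  have less: "i < j + m" if "i \<in> set u" "j \<in> set v" for i j
    using that u(2) v by force
  have lo: "rank ?C i = rank (set u) i" if "i \<in> set u" for i
  proof -
    have "{j \<in> ?C. j \<le> i} = {j \<in> set u. j \<le> i}"
      by (force simp: v'_def dest: less[OF that])
    then show ?thesis by (simp add: rank_def)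
  qed
  have hi: "rank ?C (i + m) = rank (set v) i + length u" if "i \<in> set v" for i
  proof -
    have "{j \<in> ?C. j \<le> i + m} = set u \<union> (\<lambda>j. j + m) ` {j \<in> set v. j \<le> i}"
      using that by (auto simp: v'_def intro: less_imp_le[OF less])
    moreover have "set u \<inter> (\<lambda>j. j + m) ` {j \<in> set v. j \<le> i} = {}"
      by (auto dest: less)
    ultimately show ?thesis
      using u(1) by (simp add: rank_def card_Un_disjoint card_image distinct_card)
  qed
  have "inj_on standardize (shuffles u v')"
  proof (rule inj_onI)
    fix w w' assume w: "w \<in> shuffles u v'" "w' \<in> shuffles u v'" "standardize w = standardize w'"
    have "inj_on (rank ?C) (set w \<union> set w')"
      using set_shuffles[OF w(1)] set_shuffles[OF w(2)] inj_on_rank[of ?C] by simp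
    then show "w = w'" using w std by (metis map_inj_on)
  qed
  moreover have "standardize ` shuffles u v' =
      shuffles (standardize u) (map (\<lambda>i. i + length u) (standardize v))"
  proof -
    have "standardize ` shuffles u v' = map (rank ?C) ` shuffles u v'"
      using std by (intro image_cong) auto
    also have "\<dots> = shuffles (map (rank ?C) u) (map (rank ?C) v')"
      by (simp only: shuffles_map)
    also have "map (rank ?C) u = standardize u"
      using lo by (simp add: standardize_eq_map_rank)
    also have "map (rank ?C) v' = map (\<lambda>i. i + length u) (standardize v)"
      using hi by (simp add: standardize_eq_map_rank v'_def)
    finally show ?thesis .
  qed
  ultimately show ?thesis by (simp add: bij_betw_def)
qed

section \<open>Standardized subwords of a decorated permutation\<close>

text \<open>This is \<open>std_decorated\<close> for a subword that is given by its letters instead of its positions.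
  It may differ from \<open>(w, z)\<close> even when \<open>w\<close> is a permutation of full size \<open>p\<close>, since \<open>select z {1..p}\<close>
  need not be \<open>z\<close>. For this reason the formulas for products and coproducts below come in two
  versions, one for \<open>(\<rho>, z)\<close> and one for \<open>std_word select z w\<close>.\<close>

definition std_word :: "('x \<Rightarrow> nat set \<Rightarrow> 'x) \<Rightarrow> 'x \<Rightarrow> nat list \<Rightarrow> nat list \<times> 'x" where
  "std_word select z w = (standardize w, select z (set w))"

lemma dp_comult_basis:
  "dp_comult select (basis (\<rho>, z)) =
    (\<Sum>k\<le>length \<rho>. basis (std_word select z (take k \<rho>), std_word select z (drop k \<rho>)))"
proof -
  have "std_decorated select (\<rho>, z) {1..k} = std_word select z (take k \<rho>)"
    if "k \<le> length \<rho>" for k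
  proof -
    have "{i. Suc i \<in> {1..k}} = {..<k}" by auto
    moreover have "{1..k} = Suc ` {0..<k}"
      by (simp add: image_Suc_atLeastLessThan atLeastLessThanSuc_atLeastAtMost)
    then have "(\<lambda>i. \<rho> ! (i - 1)) ` {1..k} = (!) \<rho> ` {0..<k}"
      by (simp only: image_image diff_Suc_1)
    then have "(\<lambda>i. \<rho> ! (i - 1)) ` {1..k} = set (take k \<rho>)"
      using that by (simp only: nth_image)
    ultimately show ?thesis by (simp add: std_decorated_def std_word_def stdp_def)
  qed
  moreover have "std_decorated select (\<rho>, z) ({1..length \<rho>} - {1..k}) =
      std_word select z (drop k \<rho>)" if "k \<le> length \<rho>" for k
  proof -
    have "{1..length \<rho>} - {1..k} = Suc ` {k..<length \<rho>}"
      by (auto simp: image_Suc_atLeastLessThan)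
    then have "(\<lambda>i. \<rho> ! (i - 1)) ` ({1..length \<rho>} - {1..k}) = (!) \<rho> ` {k..<length \<rho>}"
      by (simp only: image_image diff_Suc_1)
    also have "\<dots> = set (drop k \<rho>)"
    proof -
      have "drop k \<rho> = map ((!) \<rho>) [k..<length \<rho>]" by (rule nth_equalityI) auto
      then show ?thesis by (metis image_set atLeastLessThan_upt)
    qed
    finally have "(\<lambda>i. \<rho> ! (i - 1)) ` ({1..length \<rho>} - {1..k}) = set (drop k \<rho>)" .
    moreover have "nths \<rho> {i. Suc i \<in> {1..length \<rho>} - {1..k}} = drop k \<rho>"
      \<comment> \<open>\<open>nths\<close> only looks at positions below \<open>length \<rho>\<close>.\<close>
      unfolding drop_eq_nths nths_def by (intro arg_cong[of _ _ "map fst"] filter_cong)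
        (auto simp: set_zip)
    ultimately show ?thesis by (simp add: std_decorated_def std_word_def stdp_def)
  qed
  ultimately show ?thesis by (simp add: dp_comult_def)
qed

lemma dp_mult_basis:
  assumes "\<sigma> \<in> perms m" "\<tau> \<in> perms n"
  shows "dp_mult conc (basis (\<sigma>, x)) (basis (\<tau>, y)) =
    (\<Sum>\<rho>\<in>shuffles \<sigma> (map (\<lambda>v. v + m) \<tau>). basis (\<rho>, conc x y))"
  by (simp add: dp_mult_def shifted_shuffle_eq_shuffles[OF assms])

lemma dp_mult_sum_left: "dp_mult conc (\<Sum>i\<in>I. f i) y = (\<Sum>i\<in>I. dp_mult conc (f i) y)"
  and dp_mult_sum_right: "dp_mult conc x (\<Sum>j\<in>J. g j) = (\<Sum>j\<in>J. dp_mult conc x (g j))"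
  by (simp_all add: dp_mult_def bilin_ext_sum_left bilin_ext_sum_right)

context decoration_set
begin

abbreviation pack :: "'x \<Rightarrow> nat list \<Rightarrow> nat list \<times> 'x" where
  "pack \<equiv> std_word select"

lemma pack_in_decorated_perms:
  assumes "z \<in> X p" "distinct w" "set w \<subseteq> {1..p}"
  shows "pack z w \<in> decorated_perms X (length w)"
  using assms standardize_in_perms[of w] select_closed[of z p "set w"]
  by (simp add: std_word_def decorated_perms_def distinct_card)

text \<open>Standardizing a subword of the standardization of \<open>w\<close> is standardizing the corresponding
  subword \<open>u\<close> of \<open>w\<close>, because \<open>rank (set w)\<close> preserves the order. On decorations, \<open>rank (set w)\<close> is
  undone by \<open>nth_elem (set w)\<close> in \<open>select_select\<close>.\<close>

lemma pack_pack:
  assumes z: "z \<in> X p" and w: "distinct w" "set w \<subseteq> {1..p}" and u: "set u \<subseteq> set w"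
  shows "pack (select z (set w)) (map (rank (set w)) u) = pack z u"
proof -
  have "standardize (map (rank (set w)) u) = standardize u"
    using u by (intro standardize_map)
      (auto intro: monotone_on_subset strict_mono_on_rank[of "set w"])
  moreover have "select (select z (set w)) (rank (set w) ` set u) =
      select z (nth_elem (set w) ` rank (set w) ` set u)"
    using z w u rank_image[of "set w"] by (intro select_select) auto
  moreover have "nth_elem (set w) ` rank (set w) ` set u = set u"
    using u by (force simp: image_image nth_elem_rank)
  ultimately show ?thesis by (simp add: std_word_def)
qed

lemma dp_comult_pack:
  assumes "z \<in> X p" "distinct w" "set w \<subseteq> {1..p}"
  shows "dp_comult select (basis (pack z w)) =
    (\<Sum>k\<le>length w. basis (pack z (take k w), pack z (drop k w)))"
  using pack_pack[OF assms]
  by (simp add: std_word_def[of select z w] dp_comult_basis standardize_eq_map_rank[of w]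
      take_map drop_map set_take_subset set_drop_subset)

text \<open>Standardization matches the shuffles of the standardized words with those of \<open>u\<close> and the
  shifted \<open>v\<close>. All these shuffles have the letters \<open>set u\<close> together with the shifted \<open>set v\<close>, the set
  that \<open>conc_select\<close> selects from \<open>conc x y\<close>.\<close>

lemma dp_mult_pack:
  assumes x: "x \<in> X m" and u: "distinct u" "set u \<subseteq> {1..m}"
    and y: "y \<in> X n" and v: "distinct v" "set v \<subseteq> {1..n}"
  shows "dp_mult conc (basis (pack x u)) (basis (pack y v)) =
    (\<Sum>w\<in>shuffles u (map (\<lambda>i. i + m) v). basis (pack (conc x y) w))"
proof -
  let ?z = "conc (select x (set u)) (select y (set v))"
  have "dp_mult conc (basis (pack x u)) (basis (pack y v)) =
      (\<Sum>\<rho>\<in>shuffles (standardize u) (map (\<lambda>i. i + length u) (standardize v)). basis (\<rho>, ?z))"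
    using u v by (simp add: std_word_def dp_mult_basis[OF standardize_in_perms standardize_in_perms])
  also have "\<dots> = (\<Sum>w\<in>shuffles u (map (\<lambda>i. i + m) v). basis (standardize w, ?z))"
    by (rule sum.reindex_bij_betw[OF standardize_shuffles[OF u v(2)], symmetric])
  also have "\<dots> = (\<Sum>w\<in>shuffles u (map (\<lambda>i. i + m) v). basis (pack (conc x y) w))"
    using conc_select[OF x y u(2) v(2)]
    by (intro sum.cong) (auto simp: std_word_def dest: set_shuffles)
  finally show ?thesis .
qed

lemma dp_mult_assoc_basis:
  assumes "a \<in> decorated_perms X l" "b \<in> decorated_perms X m" "c \<in> decorated_perms X n"
  shows "dp_mult conc (dp_mult conc (basis a) (basis b)) (basis c) =
    dp_mult conc (basis a) (dp_mult conc (basis b) (basis c))"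
proof -
  obtain \<sigma> x \<tau> y \<upsilon> z where abc: "a = (\<sigma>, x)" "b = (\<tau>, y)" "c = (\<upsilon>, z)"
    and perms: "\<sigma> \<in> perms l" "\<tau> \<in> perms m" "\<upsilon> \<in> perms n"
    and X: "x \<in> X l" "y \<in> X m" "z \<in> X n"
    using assms by (auto simp: decorated_perms_def)
  let ?sh = "\<lambda>k. map (\<lambda>v. v + k)"
  let ?g = "\<lambda>\<rho>. basis (\<rho>, conc (conc x y) z)"
  note setD = permutations_of_setD(1)
  have "dp_mult conc (dp_mult conc (basis a) (basis b)) (basis c) =
      (\<Sum>\<alpha>\<in>shuffles \<sigma> (?sh l \<tau>). dp_mult conc (basis (\<alpha>, conc x y)) (basis c))"
    by (simp add: abc dp_mult_basis[OF perms(1,2)] dp_mult_sum_left)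
  also have "\<dots> = (\<Sum>\<alpha>\<in>shuffles \<sigma> (?sh l \<tau>). \<Sum>\<rho>\<in>shuffles \<alpha> (?sh (l + m) \<upsilon>). ?g \<rho>)"
    unfolding abc
    by (intro sum.cong refl dp_mult_basis[OF shuffles_in_perms[OF perms(1,2)] perms(3)])
  also have "\<dots> = (\<Sum>\<beta>\<in>shuffles (?sh l \<tau>) (?sh (l + m) \<upsilon>). \<Sum>\<rho>\<in>shuffles \<sigma> \<beta>. ?g \<rho>)"
    using setD[OF perms(1)] setD[OF perms(2)] setD[OF perms(3)]
    by (intro sum_shuffles_assoc) auto
  also have "shuffles (?sh l \<tau>) (?sh (l + m) \<upsilon>) = ?sh l ` shuffles \<tau> (?sh m \<upsilon>)"
    \<comment> \<open>Shifting \<open>\<upsilon>\<close> by \<open>l + m\<close> amounts to shifting it by \<open>m\<close> for the product with \<open>\<tau>\<close>, and then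
      the whole shuffle by \<open>l\<close> for the product with \<open>\<sigma>\<close>.\<close>
    by (simp add: shuffles_map[symmetric] o_def add.commute add.left_commute)
  also have "(\<Sum>\<beta>\<in>?sh l ` shuffles \<tau> (?sh m \<upsilon>). \<Sum>\<rho>\<in>shuffles \<sigma> \<beta>. ?g \<rho>) =
      (\<Sum>\<beta>\<in>shuffles \<tau> (?sh m \<upsilon>). \<Sum>\<rho>\<in>shuffles \<sigma> (?sh l \<beta>). ?g \<rho>)"
    by (subst sum.reindex) (auto simp: inj_on_def inj_map_eq_map)
  also have "\<dots> = (\<Sum>\<beta>\<in>shuffles \<tau> (?sh m \<upsilon>).
      dp_mult conc (basis a) (basis (\<beta>, conc y z)))"
    unfolding abc conc_assoc[OF X, symmetric]
    by (intro sum.cong refl dp_mult_basis[OF perms(1) shuffles_in_perms[OF perms(2,3)], symmetric])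
  also have "\<dots> = dp_mult conc (basis a) (dp_mult conc (basis b) (basis c))"
    by (simp add: abc dp_mult_basis[OF perms(2,3)] dp_mult_sum_right)
  finally show ?thesis .
qed

lemma dp_comult_coassoc_basis:
  assumes "a \<in> decorated_perms X n"
  shows "tensor_assoc (tensor_map (dp_comult select) id (dp_comult select (basis a))) =
    tensor_map id (dp_comult select) (dp_comult select (basis a))"
proof -
  obtain \<rho> z where a: "a = (\<rho>, z)" and \<rho>: "\<rho> \<in> perms n" and z: "z \<in> X n"
    using assms by (auto simp: decorated_perms_def)
  have sub: "distinct (take k \<rho>)" "set (take k \<rho>) \<subseteq> {1..n}"
    "distinct (drop k \<rho>)" "set (drop k \<rho>) \<subseteq> {1..n}" for k
    using permutations_of_setD[OF \<rho>] set_take_subset[of k \<rho>] set_drop_subset[of k \<rho>] by auto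
  have "tensor_assoc (tensor_map (dp_comult select) id (dp_comult select (basis a))) =
      (\<Sum>k\<le>length \<rho>. \<Sum>j\<le>k. basis (pack z (take j \<rho>),
         pack z (drop j (take k \<rho>)), pack z (drop k \<rho>)))"
    by (simp add: a dp_comult_basis[of select \<rho>] tensor_map_def tensor_assoc_def lin_ext_sum
        dp_comult_pack[OF z sub(1,2)] tensor_sum_left min_absorb1 min_absorb2)
  also have "\<dots> = (\<Sum>j\<le>length \<rho>. \<Sum>i\<le>length \<rho> - j. basis (pack z (take j \<rho>),
         pack z (take i (drop j \<rho>)), pack z (drop i (drop j \<rho>))))"
    by (rule sum_deconcatenate_twice)
  also have "\<dots> = tensor_map id (dp_comult select) (dp_comult select (basis a))"
    by (simp add: a dp_comult_basis[of select \<rho>] tensor_map_def lin_ext_sum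
        dp_comult_pack[OF z sub(3,4)] tensor_sum_right)
  finally show ?thesis .
qed

lemma dp_comult_mult_basis:
  assumes "a \<in> decorated_perms X m" "b \<in> decorated_perms X n"
  shows "dp_comult select (dp_mult conc (basis a) (basis b)) =
    tensor_mult (dp_mult conc) (dp_comult select (basis a)) (dp_comult select (basis b))"
proof -
  obtain \<sigma> x \<tau> y where ab: "a = (\<sigma>, x)" "b = (\<tau>, y)"
    and perms: "\<sigma> \<in> perms m" "\<tau> \<in> perms n" and X: "x \<in> X m" "y \<in> X n"
    using assms by (auto simp: decorated_perms_def)
  let ?sh = "map (\<lambda>v. v + m)" and ?z = "conc x y"
  have sub: "distinct (take k \<rho>)" "set (take k \<rho>) \<subseteq> {1..p}"
    "distinct (drop k \<rho>)" "set (drop k \<rho>) \<subseteq> {1..p}" if "\<rho> \<in> perms p" for k p \<rho>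
    using permutations_of_setD[OF that] set_take_subset[of k \<rho>] set_drop_subset[of k \<rho>] by auto
  note subs = sub[OF perms(1)] and subt = sub[OF perms(2)]
  have "dp_comult select (dp_mult conc (basis a) (basis b)) =
      (\<Sum>\<rho>\<in>shuffles \<sigma> (?sh \<tau>). dp_comult select (basis (\<rho>, ?z)))"
    by (simp add: ab dp_mult_basis[OF perms] dp_comult_def lin_ext_sum)
  also have "\<dots> = (\<Sum>\<rho>\<in>shuffles \<sigma> (?sh \<tau>). \<Sum>k\<le>length \<rho>.
      basis (pack ?z (take k \<rho>), pack ?z (drop k \<rho>)))"
    by (simp only: dp_comult_basis)
  also have "\<dots> = (\<Sum>i\<le>length \<sigma>. \<Sum>j\<le>length (?sh \<tau>).
      \<Sum>u\<in>shuffles (take i \<sigma>) (take j (?sh \<tau>)).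
      \<Sum>v\<in>shuffles (drop i \<sigma>) (drop j (?sh \<tau>)). basis (pack ?z u, pack ?z v))"
    using permutations_of_setD(1)[OF perms(1)] permutations_of_setD(1)[OF perms(2)]
    by (intro sum_shuffles_deconcatenate) auto
  also have "\<dots> = (\<Sum>i\<le>length \<sigma>. \<Sum>j\<le>length \<tau>.
      tensor (dp_mult conc (basis (pack x (take i \<sigma>))) (basis (pack y (take j \<tau>))))
        (dp_mult conc (basis (pack x (drop i \<sigma>))) (basis (pack y (drop j \<tau>)))))"
    by (simp add: dp_mult_pack[OF X(1) subs(1,2) X(2) subt(1,2)]
        dp_mult_pack[OF X(1) subs(3,4) X(2) subt(3,4)] tensor_sum
        take_map drop_map)
  also have "\<dots> = tensor_mult (dp_mult conc) (dp_comult select (basis a)) (dp_comult select (basis b))"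
    by (simp add: ab dp_comult_basis tensor_mult_def bilin_ext_sum)
  finally show ?thesis .
qed

end

theorem theorem13:
  fixes X :: "nat \<Rightarrow> 'x set"
    and conc :: "'x \<Rightarrow> 'x \<Rightarrow> 'x"
    and select :: "'x \<Rightarrow> nat set \<Rightarrow> 'x"
  assumes "decoration_set X conc select"
  shows "graded_hopf_algebra (decorated_perms X)
    (dp_mult conc :: (nat list \<times> 'x \<Rightarrow>\<^sub>0 'k::field) \<Rightarrow> _ \<Rightarrow> _) (dp_comult select)"
proof -
  interpret decoration_set X conc select by (rule assms)
  define h :: "nat list \<times> 'x \<Rightarrow> nat list \<times> 'x \<Rightarrow> (nat list \<times> 'x \<Rightarrow>\<^sub>0 'k)"
    where "h = (\<lambda>a b. dp_mult conc (basis a) (basis b))"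
  define d :: "nat list \<times> 'x \<Rightarrow> ((nat list \<times> 'x) \<times> (nat list \<times> 'x) \<Rightarrow>\<^sub>0 'k)"
    where "d = (\<lambda>a. dp_comult select (basis a))"
  have M: "dp_mult conc = bilin_ext h" by (simp add: h_def dp_mult_def)
  have D: "dp_comult select = lin_ext d" by (simp add: d_def dp_comult_def)
  show ?thesis
    unfolding M D
  proof (rule graded_hopf_algebra_basisI)
    show "disjoint_family (decorated_perms X)"
      using disjoint_sizes by (auto simp: disjoint_family_on_def decorated_perms_def)
    show "h a b \<in> free_on (decorated_perms X (m + n))"
      if "a \<in> decorated_perms X m" "b \<in> decorated_perms X n" for m n a b
      using that shuffles_in_perms
      by (auto simp: h_def decorated_perms_def dp_mult_basis conc_closed intro!: free_on_sum)
    show "d a \<in> free_on (\<Union>i\<le>n. decorated_perms X i \<times> decorated_perms X (n - i))"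
      if "a \<in> decorated_perms X n" for n a
    proof -
      obtain \<rho> z where a: "a = (\<rho>, z)" and \<rho>: "\<rho> \<in> perms n" and z: "z \<in> X n"
        using \<open>a \<in> decorated_perms X n\<close> by (auto simp: decorated_perms_def)
      have "pack z (take k \<rho>) \<in> decorated_perms X k \<and>
          pack z (drop k \<rho>) \<in> decorated_perms X (n - k)" if "k \<le> n" for k
        using that permutations_of_setD[OF \<rho>] set_take_subset[of k \<rho>] set_drop_subset[of k \<rho>]
          pack_in_decorated_perms[OF z, of "take k \<rho>"] pack_in_decorated_perms[OF z, of "drop k \<rho>"]
        by (simp add: length_perm[OF \<rho>])
      then show ?thesis
        unfolding d_def a dp_comult_basis length_perm[OF \<rho>] by (intro free_on_sum) auto
    qed
    show "bilin_ext h (h a b) (basis c) = bilin_ext h (basis a) (h b c)"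
      if "a \<in> decorated_perms X l" "b \<in> decorated_perms X m" "c \<in> decorated_perms X n"
      for l m n a b c
      using dp_mult_assoc_basis[OF that] unfolding M[symmetric] unfolding h_def .
    show "tensor_assoc (tensor_map (lin_ext d) id (d a)) = tensor_map id (lin_ext d) (d a)"
      if "a \<in> decorated_perms X n" for n a
      using dp_comult_coassoc_basis[OF that] unfolding D[symmetric] unfolding d_def .
    show "lin_ext d (h a b) = tensor_mult (bilin_ext h) (d a) (d b)"
      if "a \<in> decorated_perms X m" "b \<in> decorated_perms X n" for m n a b
      using dp_comult_mult_basis[OF that] unfolding M[symmetric] D[symmetric] unfolding h_def d_def .
  qed
qed

end
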